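(* There exist a constant $C$ and infinitely many (pairwise non-isomorphic) finite simple $2$-vertex-connected cubic graphs $G$, each having an edge $st\in E(G)$ such that $$\mathrm{OPT}(G,s,t)\ge \tfrac54|V(G)|-C.$$ In particular, for every real $\alpha<5/4$ and every constant $C'$, it is not true that $\mathrm{OPT}(G,s,t)\le\alpha|V(G)|+C'$ for all finite simple $2$-connected cubic graphs $G$ and all distinct $s,t\in V(G)$ (hence such a bound also fails for the class of all simple $2$-connected subcubic graphs).
   Context: A graph is cubic if every vertex has degree $3$, and subcubic if its maximum degree is at most $3$. "$2$-connected" means $2$-vertex-connected. For a connected graph $G$ and distinct vertices $s,t$, $\mathrm{OPT}(G,s,t)$ is the length (number of edges, counted with repetition) of a shortest walk in $G$ from $s$ to $t$ that visits every vertex of $G$ (vertices and edges may be repeated). Equivalently, it is the minimum number of edges of a connected spanning multigraph on $V(G)$ whose edges are copies of edges of $G$ and whose set of odd-degree vertices is exactly $\{s,t\}$. *)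

theory Defs
  imports Complex_Main "Graph_Theory.Graph_Theory"
begin

text \<open>
  Simple undirected graphs are symmetric loop-free pair digraphs (\<^locale>\<open>pair_graph\<close>, which
  includes finiteness): the edge \<open>uv\<close> is the pair of arcs \<open>(u,v)\<close> and \<open>(v,u)\<close>.
  Hence the degree of a vertex is its out-degree (not the sum of in- and out-degree),
  and each arc of a walk counts as one traversed edge.
\<close>

definition cubic :: "'a pair_pre_digraph \<Rightarrow> bool" where
  "cubic G \<longleftrightarrow> (\<forall>v \<in> pverts G. out_degree (with_proj G) v = 3)"

definition subcubic :: "'a pair_pre_digraph \<Rightarrow> bool" where
  "subcubic G \<longleftrightarrow> (\<forall>v \<in> pverts G. out_degree (with_proj G) v \<le> 3)"

definition two_connected :: "'a pair_pre_digraph \<Rightarrow> bool" where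
  "two_connected G \<longleftrightarrow>
     card (pverts G) > 2 \<and> connected (with_proj G) \<and>
     (\<forall>v \<in> pverts G. connected (pre_digraph.del_vert (with_proj G) v))"

definition spanning_walk :: "'a pair_pre_digraph \<Rightarrow> 'a \<Rightarrow> ('a \<times> 'a) awalk \<Rightarrow> 'a \<Rightarrow> bool" where
  "spanning_walk G s p t \<longleftrightarrow>
     pre_digraph.awalk (with_proj G) s p t \<and>
     set (pre_digraph.awalk_verts (with_proj G) s p) = pverts G"

text \<open>
  A connected finite graph has a spanning walk between any two of its vertices, so the minimum
  below is attained; it is meaningless on disconnected graphs.
\<close>

definition OPT :: "'a pair_pre_digraph \<Rightarrow> 'a \<Rightarrow> 'a \<Rightarrow> nat" where
  "OPT G s t = (LEAST n. \<exists>p. spanning_walk G s p t \<and> length p = n)"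

end

theory Submission
  imports Defs
begin

text \<open>The graphs are built by nesting. A diamond is \<open>K\<^sub>4\<close> minus an edge, entered through its two tips.
  Start from a diamond; in each layer, join one end of the current piece and one tip of a new
  diamond to a vertex \<open>u\<close>, the other end and the other tip to a vertex \<open>v\<close>, and attach to
  \<open>u\<close>, \<open>v\<close> a pair of adjacent vertices, which are the new ends. A layer has 8 vertices. A walk whose two ends lie outside a piece
  traverses the two edges that leave the piece an even number of times in total. Hence both
  edges are used oddly or both evenly; let \<open>w\<close> count the traversals of edges meeting the piece.
  For a diamond, \<open>w \<ge> 5\<close> in the odd case and \<open>w \<ge> 6\<close> in the even case. At \<open>u\<close> and \<open>v\<close> three
  pairs of edges meet: those leaving the old piece, those leaving the new diamond, and those leading
  to the new ends. As degrees are even, two or none of these pairs are odd. Together with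
  connectivity this yields \<open>w \<ge> 10 j + 5\<close>, respectively \<open>w \<ge> 10 j + 6\<close>, after \<open>j\<close> layers, that
  is, 10 steps per 8 vertices.\<close>

section \<open>2-connectivity from an st-numbering\<close>

text \<open>Since \<open>f\<close> takes natural values, repeated descent from any vertex ends at
  \<open>r\<close>; symmetry reverses these walks.\<close>

lemma (in wf_digraph) connected_if_descending:
  fixes f :: "'a \<Rightarrow> nat"
  assumes sym: "symmetric G" and r: "r \<in> verts G"
    and desc: "\<And>v. v \<in> verts G \<Longrightarrow> v \<noteq> r \<Longrightarrow> \<exists>w. (v, w) \<in> arcs_ends G \<and> f w < f v"
  shows "connected G"
proof -
  have to_r: "v \<rightarrow>\<^sup>* r" if "v \<in> verts G" for v
    using that
  proof (induction "f v" arbitrary: v rule: less_induct)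
    case less
    show ?case
    proof (cases "v = r")
      case True
      then show ?thesis using r by simp
    next
      case False
      then obtain w where w: "v \<rightarrow> w" "f w < f v" using desc less.prems by blast
      then have "w \<rightarrow>\<^sup>* r" using less.hyps adj_in_verts(2) by blast
      with w(1) show ?thesis by (rule adj_reachable_trans)
    qed
  qed
  have "strongly_connected G"
    using r to_r symmetric_reachable[OF sym] by (blast intro: reachable_trans)
  then show ?thesis
    using r by (auto simp: connected_def strongly_connected_def reachable_mk_symmetric_eq[OF sym])
qed

text \<open>When \<open>x\<close> is deleted, the vertices that \<open>h\<close> places at most as high as \<open>x\<close> descend to \<open>s\<close>, and
  the higher ones climb to \<open>t\<close> and cross the edge \<open>st\<close>; neither kind of path meets \<open>x\<close>.\<close>

lemma two_connected_if_st_numbering: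
  fixes h :: "'a \<Rightarrow> nat"
  assumes G: "pair_graph G" and card: "card (pverts G) > 2" and st: "(s, t) \<in> parcs G"
    and down: "\<And>v. v \<in> pverts G \<Longrightarrow> v \<noteq> s \<Longrightarrow> \<exists>w. (v, w) \<in> parcs G \<and> h w < h v"
    and up: "\<And>v. v \<in> pverts G \<Longrightarrow> v \<noteq> t \<Longrightarrow> \<exists>w. (v, w) \<in> parcs G \<and> h v < h w"
  shows "two_connected G"
proof -
  interpret pair_graph G by (rule G)
  have s: "s \<in> pverts G" and t: "t \<in> pverts G" using st wellformed' by auto
  have ts: "(t, s) \<in> parcs G" using st by (rule arcs_symmetric)
  define H where "H = Max (h ` pverts G)"
  have le_H: "h v \<le> H" if "v \<in> pverts G" for v
    using that pair_finite_verts by (simp add: H_def)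
  have "H \<in> h ` pverts G" unfolding H_def using s pair_finite_verts by (intro Max_in) auto
  then obtain m where m: "m \<in> pverts G" "h m = H" by auto
  have ht: "h t = H"
  proof (rule ccontr)
    assume "h t \<noteq> H"
    then have "m \<noteq> t" using m by auto
    then obtain w where "(m, w) \<in> parcs G" "h m < h w" using up m by blast
    then show False using m le_H[of w] wellformed'(2) by fastforce
  qed
  have "connected (with_proj G)"
    using connected_if_descending[where r = s and f = h] sym_arcs s down by auto
  moreover have "connected (pre_digraph.del_vert (with_proj G) x)" if x: "x \<in> pverts G" for x
  proof -
    let ?D = "pre_digraph.del_vert (with_proj G) x"
    interpret D: wf_digraph ?D by (rule wf_digraph_del_vert)
    have ends: "arcs_ends ?D = {(v, w). (v, w) \<in> parcs G \<and> v \<noteq> x \<and> w \<noteq> x}"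
      by (force simp: arcs_ends_conv del_vert_simps)
    have sym: "symmetric ?D"
      unfolding symmetric_def ends by (auto intro: symI arcs_symmetric)
    show ?thesis
    proof (cases "x = s")
      case True
      show ?thesis
      proof (rule D.connected_if_descending[OF sym, where r = t and f = "\<lambda>v. H - h v"])
        show "t \<in> verts ?D" using t True no_loops'[OF st] by (auto simp: del_vert_simps)
        fix v assume v: "v \<in> verts ?D" "v \<noteq> t"
        then have "v \<in> pverts G" "v \<noteq> s" using True by (auto simp: del_vert_simps)
        moreover obtain w where w: "(v, w) \<in> parcs G" "h v < h w"
          using up v(2) \<open>v \<in> pverts G\<close> by blast
        moreover have "w \<noteq> s"
        proof
          assume "w = s"
          \<comment> \<open>Descent from any \<open>u\<close> ends at \<open>s\<close>, so
            \<open>s\<close> is lowest and a climbing step never leads to it.\<close>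
          have "h s \<le> h u" if "u \<in> pverts G" for u
            using that
          proof (induction "h u" arbitrary: u rule: less_induct)
            case less
            then show ?case using down[of u] wellformed'(2) by (cases "u = s") fastforce+
          qed
          then show False using w \<open>w = s\<close> \<open>v \<in> pverts G\<close> by fastforce
        qed
        moreover have "h w \<le> H" using w le_H wellformed'(2) by blast
        ultimately show "\<exists>w. (v, w) \<in> arcs_ends ?D \<and> H - h w < H - h v"
          unfolding ends using True by (intro exI[of _ w]) auto
      qed
    next
      case False
      \<comment> \<open>Above \<open>x\<close> the order is reversed. As \<open>h v \<le> H\<close>,
        these values stay positive, so \<open>t\<close> can step down to \<open>s\<close>, which
        gets 0.\<close>
      let ?f = "\<lambda>v. if v = s then 0 else if h v \<le> h x then h v else 2 * H + 1 - h v"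
      show ?thesis
      proof (rule D.connected_if_descending[OF sym, where r = s and f = ?f])
        show "s \<in> verts ?D" using s False by (auto simp: del_vert_simps)
        fix v assume v': "v \<in> verts ?D" "v \<noteq> s"
        then have v: "v \<in> pverts G" "v \<noteq> x" "v \<noteq> s" by (auto simp: del_vert_simps)
        consider "h v \<le> h x" | "h v > h x" "v = t" | "h v > h x" "v \<noteq> t" by linarith
        then show "\<exists>w. (v, w) \<in> arcs_ends ?D \<and> ?f w < ?f v"
        proof cases
          case 1
          obtain w where w: "(v, w) \<in> parcs G" "h w < h v" using down v by blast
          then show ?thesis unfolding ends using 1 v by (intro exI[of _ w]) auto
        next
          case 2
          then show ?thesis unfolding ends using v ts False ht by (intro exI[of _ s]) auto
        next
          case 3
          obtain w where w: "(v, w) \<in> parcs G" "h v < h w" using up v 3 by blast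
          moreover have "h w \<le> H" using w le_H wellformed'(2) by blast
          ultimately show ?thesis unfolding ends using 3 v by (intro exI[of _ w]) auto
        qed
      qed
    qed
  qed
  ultimately show ?thesis using card by (simp add: two_connected_def)
qed

section \<open>Spanning walks\<close>

text \<open>Strong connectivity extends a walk to one further vertex after another. Existence
  ensures that the \<open>LEAST\<close> in \<open>OPT\<close> is attained.\<close>

lemma (in pair_graph) ex_spanning_walk:
  assumes conn: "connected (with_proj G)" and s: "s \<in> pverts G" and t: "t \<in> pverts G"
  shows "\<exists>p. spanning_walk G s p t"
proof -
  have sc: "strongly_connected (with_proj G)"
    using symmetric_connected_imp_strongly_connected[OF sym_arcs conn] .
  have reach: "\<exists>p. awalk x p y" if "x \<in> pverts G" "y \<in> pverts G" for x y
    using sc that unfolding strongly_connected_def by (auto simp: reachable_awalk)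
  have "\<exists>p x. awalk s p x \<and> S \<subseteq> set (awalk_verts s p)" if "finite S" "S \<subseteq> pverts G" for S
    using that
  proof (induction S)
    case empty
    have "awalk s [] s" using s by (simp add: awalk_Nil_iff)
    then show ?case by blast
  next
    case (insert y S)
    then obtain p x where p: "awalk s p x" "S \<subseteq> set (awalk_verts s p)" by auto
    obtain q where q: "awalk x q y" using reach[of x y] awalk_last_in_verts[OF p(1)] insert.prems by auto
    have "awalk s (p @ q) y" using p q by simp
    moreover have "set (awalk_verts s (p @ q)) = set (awalk_verts s p) \<union> set (awalk_verts x q)"
      by (rule set_awalk_verts_append[OF p(1) q])
    moreover have "y \<in> set (awalk_verts x q)"
      using q by (metis awalkE awalk_verts_non_Nil last_in_set)
    ultimately show ?case using p(2) by blast
  qed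
  from this[OF pair_finite_verts order_refl]
  obtain p x where p: "awalk s p x" "pverts G \<subseteq> set (awalk_verts s p)" by auto
  obtain q where q: "awalk x q t" using reach[of x t] awalk_last_in_verts[OF p(1)] t by auto
  have w: "awalk s (p @ q) t" using p q by simp
  moreover have "set (awalk_verts s (p @ q)) = pverts G"
    using set_awalk_verts_append[OF p(1) q] p(2) w by (metis Un_upper1 awalkE subset_antisym subset_trans)
  ultimately show ?thesis
    by (intro exI[of _ "p @ q"]) (simp add: spanning_walk_def del: awalk_append_iff)
qed

lemma le_OPT:
  assumes "pair_graph G" "connected (with_proj G)" "s \<in> pverts G" "t \<in> pverts G"
    and "\<And>p. spanning_walk G s p t \<Longrightarrow> k \<le> length p"
  shows "k \<le> OPT G s t"
proof -
  interpret pair_graph G by fact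
  have "\<exists>n p. spanning_walk G s p t \<and> length p = n"
    using ex_spanning_walk assms(2-4) by blast
  from LeastI_ex[OF this] obtain p where "spanning_walk G s p t" "length p = OPT G s t"
    unfolding OPT_def by blast
  with assms(5)[of p] show ?thesis by simp
qed

section \<open>Traversal counts: parity of degrees and crossing of cuts\<close>

definition traversals :: "('a \<times> 'a) list \<Rightarrow> 'a \<Rightarrow> 'a \<Rightarrow> nat" where
  "traversals p x y = count_list p (x, y) + count_list p (y, x)"

lemma traversals_commute: "traversals p x y = traversals p y x"
  by (simp add: traversals_def)

lemma length_filter_mem:
  "finite A \<Longrightarrow> length (filter (\<lambda>a. a \<in> A) p) = (\<Sum>a\<in>A. count_list p a)"
proof (induction p)
  case (Cons a p)
  have "(\<Sum>x\<in>A. count_list (a # p) x) = (\<Sum>x\<in>A. of_bool (x = a) + count_list p x)"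
    by (intro sum.cong) auto
  then show ?case using Cons by (auto simp: sum.distrib)
qed simp

text \<open>Each interior visit to \<open>w\<close> pairs an arrival with a departure; the
  \<open>of_bool\<close> terms supply the departure missing at the end and the arrival missing at
  the start.\<close>

lemma pcas_balance:
  "pcas u p v \<Longrightarrow>
   length (filter (\<lambda>a. fst a = w) p) + of_bool (w = v) = length (filter (\<lambda>a. snd a = w) p) + of_bool (w = u)"
proof (induction p arbitrary: u)
  case (Cons a p)
  then have "fst a = u" and "pcas (snd a) p v" by auto
  then show ?case using Cons.IH[of "snd a"] by (auto simp: of_bool_def split: if_splits)
qed simp

text \<open>The arc that first enters \<open>S\<close> is the witness. All cut inequalities for
  walks rest on this.\<close>

lemma pcas_crosses:
  assumes "pcas u p v" "u \<notin> S" "w \<in> set (pawalk_verts u p)" "w \<in> S"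
  shows "\<exists>x y. (x, y) \<in> set p \<and> x \<notin> S \<and> y \<in> S"
  using assms
proof (induction p arbitrary: u)
  case (Cons a p)
  show ?case
  proof (cases "snd a \<in> S")
    case True
    then show ?thesis using Cons.prems by (intro exI[of _ "fst a"] exI[of _ "snd a"]) auto
  next
    case False
    then show ?thesis using Cons.IH[of "snd a"] Cons.prems by auto
  qed
qed auto

text \<open>By balance, the sum is twice the number of departures from \<open>w\<close>.\<close>

lemma even_traversals:
  assumes cas: "pcas u p v" and w: "w \<noteq> u" "w \<noteq> v" and N: "distinct [a, b, c]"
    and nb: "\<And>y. (w, y) \<in> set p \<or> (y, w) \<in> set p \<Longrightarrow> y = a \<or> y = b \<or> y = c"
  shows "even (traversals p w a + traversals p w b + traversals p w c)"
proof -
  have eq: "(fst e = w) = (e \<in> {(w, a), (w, b), (w, c)})" "(snd e = w) = (e \<in> {(a, w), (b, w), (c, w)})"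
    if "e \<in> set p" for e
    using nb[of "snd e"] nb[of "fst e"] that by (cases e; auto)+
  have "filter (\<lambda>e. fst e = w) p = filter (\<lambda>e. e \<in> {(w, a), (w, b), (w, c)}) p"
    by (rule filter_cong[OF refl eq(1)])
  then have out: "length (filter (\<lambda>e. fst e = w) p)
      = count_list p (w, a) + count_list p (w, b) + count_list p (w, c)"
    using N length_filter_mem[of "{(w, a), (w, b), (w, c)}" p] by (simp only:) simp
  have "filter (\<lambda>e. snd e = w) p = filter (\<lambda>e. e \<in> {(a, w), (b, w), (c, w)}) p"
    by (rule filter_cong[OF refl eq(2)])
  then have into: "length (filter (\<lambda>e. snd e = w) p)
      = count_list p (a, w) + count_list p (b, w) + count_list p (c, w)"
    using N length_filter_mem[of "{(a, w), (b, w), (c, w)}" p] by (simp only:) simp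
  have "length (filter (\<lambda>e. fst e = w) p) = length (filter (\<lambda>e. snd e = w) p)"
    using pcas_balance[OF cas, of w] w by simp
  then have "traversals p w a + traversals p w b + traversals p w c
      = 2 * length (filter (\<lambda>e. fst e = w) p)"
    using out into unfolding traversals_def by linarith
  then show ?thesis by simp
qed

section \<open>Parity and connectivity in one layer\<close>

text \<open>The variables count the traversals of the edges of a diamond with tips \<open>l\<close>, \<open>r\<close> and
  middle vertices \<open>p\<close>, \<open>q\<close>: \<open>a\<close>, \<open>b\<close> belong to the edges leaving the diamond at \<open>l\<close>, \<open>r\<close>,
  and \<open>x1\<close>, \<open>x2\<close>, \<open>y\<close>, \<open>z1\<close>, \<open>z2\<close> to \<open>lp\<close>, \<open>lq\<close>, \<open>pq\<close>, \<open>pr\<close>, \<open>qr\<close>. The assumptions are even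
  degrees and nonempty cuts.\<close>

lemma diamond_bound:
  fixes a b x1 x2 y z1 z2 :: nat
  assumes "even (a + x1 + x2)" "even (b + z1 + z2)" "even (x1 + y + z1)" "even (x2 + y + z2)"
    and "a + x1 + x2 \<ge> 1" "b + z1 + z2 \<ge> 1" "x1 + y + z1 \<ge> 1" "x2 + y + z2 \<ge> 1"
    and "a + b \<ge> 1" "b + x1 + x2 \<ge> 1" "a + z1 + z2 \<ge> 1"
  shows "even (a + b) \<and> a + b + x1 + x2 + y + z1 + z2 \<ge> 5 + of_bool (even a)"
proof -
  have two: "n \<ge> 2" if "even n" "n \<ge> 1" for n :: nat using that by presburger
  have deg: "a + x1 + x2 \<ge> 2" "b + z1 + z2 \<ge> 2" "x1 + y + z1 \<ge> 2" "x2 + y + z2 \<ge> 2"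
    using assms two by auto
  have ev: "even (a + b)" using assms(1-4) by presburger
  have ab: "a + b \<ge> 2" using ev assms(9) two by blast
  \<comment> \<open>Adding the four degrees, twice the total is at least \<open>8 + a + b\<close>.
    This gives 5 from \<open>a + b \<ge> 2\<close>, and 6 from \<open>a + b \<ge> 4\<close>. If
    \<open>a\<close> and \<open>b\<close> are even with sum 2, the tip carrying both traversals must
    also reach the rest of the diamond and has degree at least 4.\<close>
  show ?thesis
  proof (cases "even a \<and> a + b < 4")
    case True
    then have "even a" "even b" "a + b = 2" using ev ab by presburger+
    then have "a = 2 \<and> b = 0 \<or> a = 0 \<and> b = 2" by presburger
    then consider "a = 2" "b = 0" | "a = 0" "b = 2" by blast
    then have "a + x1 + x2 \<ge> 4 \<or> b + z1 + z2 \<ge> 4"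
    proof cases
      case 1
      then have "x1 + x2 \<ge> 1" "even (x1 + x2)" using assms(1,10) by auto
      then show ?thesis using two[of "x1 + x2"] 1 by linarith
    next
      case 2
      then have "z1 + z2 \<ge> 1" "even (z1 + z2)" using assms(2,11) by auto
      then show ?thesis using two[of "z1 + z2"] 2 by linarith
    qed
    then show ?thesis using deg ab ev by auto
  next
    case False
    then show ?thesis using deg ab ev by auto
  qed
qed

text \<open>\<open>W\<close> and \<open>D\<close> are the traversals meeting the old piece and the new diamond, with leaving edges
  \<open>e\<close>, \<open>f\<close> and \<open>a\<close>, \<open>b\<close>. The first of each pair ends in \<open>u\<close>, the second in \<open>v\<close>. The edges \<open>c\<close>,
  \<open>d\<close> lead from \<open>u\<close>, \<open>v\<close> to the new ends, \<open>g\<close> joins the new ends, and \<open>e'\<close>, \<open>f'\<close> leave them.\<close>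

lemma layer_bound:
  fixes N W D e f a b c d g e' f' :: nat
  assumes W: "W \<ge> N + 5 + of_bool (even e)" and D: "D \<ge> 5 + of_bool (even a)"
    and ev: "even (e + f)" "even (a + b)" "even (e + a + c)" "even (f + b + d)"
      "even (c + g + e')" "even (d + g + f')"
    and cut: "c + d \<ge> 1" "e' + f' \<ge> 1" "c + g + e' \<ge> 1" "d + g + f' \<ge> 1"
      "d + g + e' \<ge> 1" "c + g + f' \<ge> 1"
  shows "even (e' + f') \<and> W + D + (c + d + g + e' + f') \<ge> N + 15 + of_bool (even e')"
proof -
  have evs: "even (c + d)" "even (e' + f')" using ev by presburger+
  have two: "n \<ge> 2" if "even n" "n \<ge> 1" for n :: nat using that by presburger
  have cd: "c + d \<ge> 2" "e' + f' \<ge> 2" using evs cut two by auto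
  show ?thesis
  proof (cases "even c")
    case False
    \<comment> \<open>By parity at \<open>u\<close>, exactly one of \<open>e\<close> and
      \<open>a\<close> is even, which costs one extra step.\<close>
    then have "W + D \<ge> N + 11" using W D ev by (cases "even e") auto
    moreover have "g \<ge> 1" if "even e'"
      using that False ev by (cases g) auto
    ultimately show ?thesis using cd evs by (auto split: if_splits)
  next
    case True
    have WD: "W + D \<ge> N + 10" using W D by (auto split: if_splits)
    show ?thesis
    proof (cases "even e'")
      case False
      then have "g \<ge> 1" using True ev by (cases g) auto
      then show ?thesis using False WD cd evs by auto
    next
      case e': True
      then have "even d" "even g" "even f'" using True evs ev by auto
      then obtain c2 d2 g2 e2 f2 where h: "c = 2 * c2" "d = 2 * d2" "g = 2 * g2" "e' = 2 * e2" "f' = 2 * f2"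
        using True e' by (auto elim!: evenE)
      have "c2 + d2 \<ge> 1" "e2 + f2 \<ge> 1" "c2 + g2 + e2 \<ge> 1" "d2 + g2 + f2 \<ge> 1"
        "d2 + g2 + e2 \<ge> 1" "c2 + g2 + f2 \<ge> 1"
        using cut unfolding h by linarith+
      \<comment> \<open>Contract everything inside the new ends to one vertex and everything outside
        them to another. The halved counts form a connected multigraph on these two and the new
        ends, and four vertices need three edges.\<close>
      then have "c2 + d2 + g2 + e2 + f2 \<ge> 3"
        by (cases "c2 = 0"; cases "d2 = 0"; cases "e2 = 0"; cases "f2 = 0"; linarith)
      then show ?thesis using h WD evs e' by auto
    qed
  qed
qed

section \<open>Nested diamonds\<close>

definition vx :: "nat \<Rightarrow> nat \<Rightarrow> nat" where
  "vx j c = 8 * j + c"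

lemma vx_div [simp]: "c < 8 \<Longrightarrow> vx j c div 8 = j"
  and vx_mod [simp]: "c < 8 \<Longrightarrow> vx j c mod 8 = c"
  by (auto simp: vx_def div_nat_eqI)

lemma vx_eq_iff [simp]: "c < 8 \<Longrightarrow> d < 8 \<Longrightarrow> vx i c = vx j d \<longleftrightarrow> i = j \<and> c = d"
  by (metis vx_div vx_mod)

lemma vx_less_iff [simp]: "c < 8 \<Longrightarrow> vx j c < 8 * K + 8 \<longleftrightarrow> j \<le> K"
  by (auto simp: vx_def)

lemma vx_cases:
  assumes "x < 8 * K + 8"
  obtains j where "j \<le> K" "x = vx j 0" | j where "j \<le> K" "x = vx j 1" | j where "j \<le> K" "x = vx j 2"
    | j where "j \<le> K" "x = vx j 3" | j where "j \<le> K" "x = vx j 4" | j where "j \<le> K" "x = vx j 5"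
    | j where "j \<le> K" "x = vx j 6" | j where "j \<le> K" "x = vx j 7"
proof -
  obtain j c where x: "x = vx j c" "c < 8" "j \<le> K"
    using assms by (intro that[of "x div 8" "x mod 8"]) (auto simp: vx_def)
  have "c = 0 \<or> c = 1 \<or> c = 2 \<or> c = 3 \<or> c = 4 \<or> c = 5 \<or> c = 6 \<or> c = 7" using x(2) by presburger
  then show thesis using that x by (elim disjE) auto
qed

text \<open>In layer \<open>j\<close> the indices 0, 1, 2, 3 are the diamond (tips 0 and 3), 4 and 5 are \<open>u\<close> and \<open>v\<close>,
  and 6 and 7 are the new ends; layer \<open>j\<close> wraps the diamond of layer \<open>Suc j\<close>. In the
  outermost layer \<open>K\<close> there is no further diamond to wrap, and the two edges from 4 to 7 and from
  5 to 6 restore 3-regularity.\<close>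

definition nest_edges :: "nat \<Rightarrow> (nat \<times> nat) set" where
  "nest_edges K =
     (\<Union>j\<le>K. {(vx j 0, vx j 1), (vx j 0, vx j 2), (vx j 1, vx j 2), (vx j 1, vx j 3), (vx j 2, vx j 3),
             (vx j 4, vx j 6), (vx j 5, vx j 7), (vx j 6, vx j 7)})
     \<union> {(vx 0 0, vx 0 4), (vx 0 3, vx 0 5)}
     \<union> (\<Union>j<K. {(vx j 4, vx (Suc j) 0), (vx j 5, vx (Suc j) 3),
               (vx j 6, vx (Suc j) 4), (vx j 7, vx (Suc j) 5)})
     \<union> {(vx K 4, vx K 7), (vx K 5, vx K 6)}"

definition nest :: "nat \<Rightarrow> nat pair_pre_digraph" where
  "nest K = \<lparr>pverts = {..<8 * K + 8}, parcs = nest_edges K \<union> (nest_edges K)\<inverse>\<rparr>"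

lemma pverts_nest [simp]: "pverts (nest K) = {..<8 * K + 8}"
  by (simp add: nest_def)

lemma nest_edges_less: "(x, y) \<in> nest_edges K \<Longrightarrow> x < y \<and> y < 8 * K + 8"
  by (auto simp: nest_edges_def vx_def)

lemma pair_graph_nest: "pair_graph (nest K)"
proof unfold_locales
  show "finite (parcs (nest K))"
    by (simp add: nest_def nest_edges_def)
  show "symmetric (with_proj (nest K))"
    by (auto simp: symmetric_def nest_def intro!: symI)
qed (auto simp: nest_def dest!: nest_edges_less)

lemma nest_nbrs:
  assumes "j \<le> K"
  shows
    "(vx j 0, y) \<in> parcs (nest K) \<longleftrightarrow> y = vx j 1 \<or> y = vx j 2 \<or> y = (case j of 0 \<Rightarrow> vx 0 4 | Suc i \<Rightarrow> vx i 4)"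
    "(vx j 1, y) \<in> parcs (nest K) \<longleftrightarrow> y = vx j 0 \<or> y = vx j 2 \<or> y = vx j 3"
    "(vx j 2, y) \<in> parcs (nest K) \<longleftrightarrow> y = vx j 0 \<or> y = vx j 1 \<or> y = vx j 3"
    "(vx j 3, y) \<in> parcs (nest K) \<longleftrightarrow> y = vx j 1 \<or> y = vx j 2 \<or> y = (case j of 0 \<Rightarrow> vx 0 5 | Suc i \<Rightarrow> vx i 5)"
    "(vx j 4, y) \<in> parcs (nest K) \<longleftrightarrow> y = vx j 6 \<or> y = (case j of 0 \<Rightarrow> vx 0 0 | Suc i \<Rightarrow> vx i 6)
       \<or> y = (if j = K then vx K 7 else vx (Suc j) 0)"
    "(vx j 5, y) \<in> parcs (nest K) \<longleftrightarrow> y = vx j 7 \<or> y = (case j of 0 \<Rightarrow> vx 0 3 | Suc i \<Rightarrow> vx i 7)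
       \<or> y = (if j = K then vx K 6 else vx (Suc j) 3)"
    "(vx j 6, y) \<in> parcs (nest K) \<longleftrightarrow> y = vx j 4 \<or> y = vx j 7 \<or> y = (if j = K then vx K 5 else vx (Suc j) 4)"
    "(vx j 7, y) \<in> parcs (nest K) \<longleftrightarrow> y = vx j 5 \<or> y = vx j 6 \<or> y = (if j = K then vx K 4 else vx (Suc j) 5)"
  using assms
  by (simp_all add: nest_def nest_edges_def Bex_def conj_disj_distribL ex_disj_distrib)
    (auto split: nat.splits)

lemma out_degree_eq_card:
  "out_degree (with_proj G) x = card {y. (x, y) \<in> parcs G}"
proof -
  have "out_arcs (with_proj G) x = Pair x ` {y. (x, y) \<in> parcs G}"
    by (auto simp: out_arcs_def)
  then show ?thesis by (simp add: out_degree_def card_image inj_on_def)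
qed

lemma cubic_nest: "cubic (nest K)"
proof -
  have three: "card {y. y = a \<or> y = b \<or> y = c} = 3" if "distinct [a, b, c]" for a b c :: nat
  proof -
    have "{y. y = a \<or> y = b \<or> y = c} = {a, b, c}" by auto
    then show ?thesis using that by simp
  qed
  show ?thesis
    unfolding cubic_def
  proof
    fix x assume "x \<in> pverts (nest K)"
    then have "x < 8 * K + 8" by simp
    then show "out_degree (with_proj (nest K)) x = 3"
      unfolding out_degree_eq_card
      by (cases x rule: vx_cases) (simp only: nest_nbrs, rule three, simp split: nat.split)+
  qed
qed

text \<open>The st-numbering: the layers form two strands, which start at \<open>s\<close> and \<open>t\<close> and meet in
  the diamonds at middle height.\<close>

definition height :: "nat \<Rightarrow> nat \<Rightarrow> nat" where
  "height K x = (let j = x div 8; c = x mod 8 in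
     if c = 0 then 2 * K + 2 else if c = 1 \<or> c = 2 then 2 * K + 3 else if c = 3 then 2 * K + 4
     else if c = 4 then 2 * (K - j) + 1 else if c = 5 then 2 * (K + j) + 5
     else if c = 6 then 2 * (K - j) else 2 * (K + j) + 6)"

lemma height_vx:
  "height K (vx j 0) = 2 * K + 2" "height K (vx j 1) = 2 * K + 3" "height K (vx j 2) = 2 * K + 3"
  "height K (vx j 3) = 2 * K + 4" "height K (vx j 4) = 2 * (K - j) + 1" "height K (vx j 5) = 2 * (K + j) + 5"
  "height K (vx j 6) = 2 * (K - j)" "height K (vx j 7) = 2 * (K + j) + 6"
  by (simp_all add: height_def)

lemma st_arc: "(vx K 6, vx K 7) \<in> parcs (nest K)"
  by (simp add: nest_nbrs)

lemma two_connected_nest: "two_connected (nest K)"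
proof (rule two_connected_if_st_numbering[OF pair_graph_nest, where h = "height K" and s = "vx K 6" and t = "vx K 7"])
  show "2 < card (pverts (nest K))" by simp
  show "(vx K 6, vx K 7) \<in> parcs (nest K)" by (rule st_arc)
  \<comment> \<open>Reduces the search for a higher or lower neighbour to the three listed by
    \<open>nest_nbrs\<close>.\<close>
  have ex3: "(\<exists>w. (w = a \<or> w = b \<or> w = c) \<and> P w) \<longleftrightarrow> P a \<or> P b \<or> P c"
    for a b c :: nat and P by blast
  fix v assume "v \<in> pverts (nest K)"
  then have v: "v < 8 * K + 8" by simp
  show "\<exists>w. (v, w) \<in> parcs (nest K) \<and> height K w < height K v" if "v \<noteq> vx K 6"
    using v that
    by (cases v rule: vx_cases) (simp_all only: nest_nbrs ex3 height_vx, auto simp: height_vx split: nat.split)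
  show "\<exists>w. (v, w) \<in> parcs (nest K) \<and> height K v < height K w" if "v \<noteq> vx K 7"
    using v that
    by (cases v rule: vx_cases) (simp_all only: nest_nbrs ex3 height_vx, auto simp: height_vx split: nat.split)
qed

section \<open>The lower bound\<close>

lemma length_filter_disjoint_le:
  assumes "\<And>x. \<not> (P x \<and> Q x)" "\<And>x. P x \<Longrightarrow> R x" "\<And>x. Q x \<Longrightarrow> R x"
  shows "length (filter P xs) + length (filter Q xs) \<le> length (filter R xs)"
  by (induction xs) (use assms in auto)

text \<open>By \<open>less\<close>, \<open>E\<close> holds each edge in one orientation only, so
  \<open>E\<close> and its swap are disjoint and no arc of \<open>p\<close> is counted
  twice.\<close>

lemma length_filter_add_traversals_le:
  fixes E :: "('a::linorder \<times> 'a) set"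
  assumes fin: "finite E" and less: "\<And>x y. (x, y) \<in> E \<Longrightarrow> x < y"
    and notP: "\<And>x y. (x, y) \<in> E \<Longrightarrow> \<not> P (x, y) \<and> \<not> P (y, x)"
    and R: "\<And>x y. (x, y) \<in> E \<Longrightarrow> R (x, y) \<and> R (y, x)" and PR: "\<And>a. P a \<Longrightarrow> R a"
  shows "length (filter P p) + (\<Sum>(x, y)\<in>E. traversals p x y) \<le> length (filter R p)"
proof -
  have disj: "E \<inter> prod.swap ` E = {}" by (auto dest!: less)
  have "(\<Sum>a\<in>prod.swap ` E. count_list p a) = (\<Sum>(x, y)\<in>E. count_list p (y, x))"
    by (subst sum.reindex) (auto intro: sum.cong)
  then have "(\<Sum>(x, y)\<in>E. traversals p x y) = (\<Sum>a\<in>E. count_list p a) + (\<Sum>a\<in>prod.swap ` E. count_list p a)"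
    by (simp add: traversals_def sum.distrib case_prod_unfold)
  also have "\<dots> = length (filter (\<lambda>a. a \<in> E \<union> prod.swap ` E) p)"
    using fin disj by (simp add: length_filter_mem sum.union_disjoint del: Un_iff)
  finally show ?thesis
    using length_filter_disjoint_le[of P "\<lambda>a. a \<in> E \<union> prod.swap ` E" R p] notP R PR by fastforce
qed

lemma traversals_ge_1:
  "(x, y) \<in> set p \<Longrightarrow> traversals p x y \<ge> 1 \<and> traversals p y x \<ge> 1"
  using count_list_0_iff[of p "(x, y)"] by (auto simp: traversals_def)

locale nest_walk =
  fixes K :: nat and p :: "(nat \<times> nat) list"
  assumes walk: "spanning_walk (nest K) (vx K 6) p (vx K 7)"
begin

abbreviation tr :: "nat \<Rightarrow> nat \<Rightarrow> nat" where
  "tr \<equiv> traversals p"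

lemma pcas: "pcas (vx K 6) p (vx K 7)"
  and set_subset: "set p \<subseteq> parcs (nest K)"
  and covers: "set (pawalk_verts (vx K 6) p) = {..<8 * K + 8}"
  using walk by (auto simp: spanning_walk_def pre_digraph.awalk_def cas_with_proj_eq awalk_verts_with_proj_eq)

lemma arc_rev: "(x, y) \<in> parcs (nest K) \<longleftrightarrow> (y, x) \<in> parcs (nest K)"
  by (auto simp: nest_def)

lemma even_tr:
  assumes "w \<noteq> vx K 6" "w \<noteq> vx K 7" "distinct [a, b, c]"
    and "\<And>y. (w, y) \<in> parcs (nest K) \<longleftrightarrow> y = a \<or> y = b \<or> y = c"
  shows "even (tr w a + tr w b + tr w c)"
proof (rule even_traversals[OF pcas assms(1-3)])
  fix y assume "(w, y) \<in> set p \<or> (y, w) \<in> set p"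
  then show "y = a \<or> y = b \<or> y = c" using set_subset arc_rev assms(4) by blast
qed

lemma crossing:
  fixes P :: "nat \<Rightarrow> nat \<Rightarrow> bool"
  assumes outside: "\<not> P K 6" and inside: "P j c" "j \<le> K" "c < 8"
    and unused:
      "\<And>i. i \<le> K \<Longrightarrow> P i 0 \<noteq> P i 1 \<Longrightarrow> tr (vx i 0) (vx i 1) = 0"
      "\<And>i. i \<le> K \<Longrightarrow> P i 0 \<noteq> P i 2 \<Longrightarrow> tr (vx i 0) (vx i 2) = 0"
      "\<And>i. i \<le> K \<Longrightarrow> P i 1 \<noteq> P i 2 \<Longrightarrow> tr (vx i 1) (vx i 2) = 0"
      "\<And>i. i \<le> K \<Longrightarrow> P i 1 \<noteq> P i 3 \<Longrightarrow> tr (vx i 1) (vx i 3) = 0"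
      "\<And>i. i \<le> K \<Longrightarrow> P i 2 \<noteq> P i 3 \<Longrightarrow> tr (vx i 2) (vx i 3) = 0"
      "\<And>i. i \<le> K \<Longrightarrow> P i 4 \<noteq> P i 6 \<Longrightarrow> tr (vx i 4) (vx i 6) = 0"
      "\<And>i. i \<le> K \<Longrightarrow> P i 5 \<noteq> P i 7 \<Longrightarrow> tr (vx i 5) (vx i 7) = 0"
      "\<And>i. i \<le> K \<Longrightarrow> P i 6 \<noteq> P i 7 \<Longrightarrow> tr (vx i 6) (vx i 7) = 0"
      "P 0 0 \<noteq> P 0 4 \<Longrightarrow> tr (vx 0 0) (vx 0 4) = 0"
      "P 0 3 \<noteq> P 0 5 \<Longrightarrow> tr (vx 0 3) (vx 0 5) = 0"
      "\<And>i. i < K \<Longrightarrow> P i 4 \<noteq> P (Suc i) 0 \<Longrightarrow> tr (vx i 4) (vx (Suc i) 0) = 0"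
      "\<And>i. i < K \<Longrightarrow> P i 5 \<noteq> P (Suc i) 3 \<Longrightarrow> tr (vx i 5) (vx (Suc i) 3) = 0"
      "\<And>i. i < K \<Longrightarrow> P i 6 \<noteq> P (Suc i) 4 \<Longrightarrow> tr (vx i 6) (vx (Suc i) 4) = 0"
      "\<And>i. i < K \<Longrightarrow> P i 7 \<noteq> P (Suc i) 5 \<Longrightarrow> tr (vx i 7) (vx (Suc i) 5) = 0"
      "P K 4 \<noteq> P K 7 \<Longrightarrow> tr (vx K 4) (vx K 7) = 0"
      "P K 5 \<noteq> P K 6 \<Longrightarrow> tr (vx K 5) (vx K 6) = 0"
  shows False
proof -
  define S where "S = {x. P (x div 8) (x mod 8)}"
  have S: "vx i d \<in> S \<longleftrightarrow> P i d" if "d < 8" for i d using that by (simp add: S_def)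
  have "vx j c \<in> set (pawalk_verts (vx K 6) p)" using inside by (simp add: covers)
  then obtain x y where xy: "(x, y) \<in> set p" "x \<notin> S" "y \<in> S"
    using pcas_crosses[OF pcas, where S = S and w = "vx j c"] inside outside S by auto
  then have "(x, y) \<in> nest_edges K \<or> (y, x) \<in> nest_edges K"
    using set_subset by (auto simp: nest_def)
  then obtain x y where "(x, y) \<in> nest_edges K" "tr x y \<noteq> 0" "(x \<in> S) \<noteq> (y \<in> S)"
    using xy traversals_ge_1[of x y p] by fastforce
  then show False
    unfolding nest_edges_def UN_iff Un_iff insert_iff empty_iff prod.inject Bex_def
    by (elim disjE exE conjE) (simp_all add: S unused del: One_nat_def)
qed

lemma even_diamond_degrees:
  assumes "j \<le> K"
  shows "even (tr (vx j 0) (case j of 0 \<Rightarrow> vx 0 4 | Suc i \<Rightarrow> vx i 4) + tr (vx j 0) (vx j 1) + tr (vx j 0) (vx j 2))"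
    "even (tr (vx j 3) (case j of 0 \<Rightarrow> vx 0 5 | Suc i \<Rightarrow> vx i 5) + tr (vx j 1) (vx j 3) + tr (vx j 2) (vx j 3))"
    "even (tr (vx j 0) (vx j 1) + tr (vx j 1) (vx j 2) + tr (vx j 1) (vx j 3))"
    "even (tr (vx j 0) (vx j 2) + tr (vx j 1) (vx j 2) + tr (vx j 2) (vx j 3))"
proof -
  have "even (tr (vx j 0) (vx j 1) + tr (vx j 0) (vx j 2) + tr (vx j 0) (case j of 0 \<Rightarrow> vx 0 4 | Suc i \<Rightarrow> vx i 4))"
    by (rule even_tr[OF _ _ _ nest_nbrs(1)[OF assms]]) (auto split: nat.splits)
  then show "even (tr (vx j 0) (case j of 0 \<Rightarrow> vx 0 4 | Suc i \<Rightarrow> vx i 4) + tr (vx j 0) (vx j 1) + tr (vx j 0) (vx j 2))"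
    by (simp only: add_ac)
  have "even (tr (vx j 3) (vx j 1) + tr (vx j 3) (vx j 2) + tr (vx j 3) (case j of 0 \<Rightarrow> vx 0 5 | Suc i \<Rightarrow> vx i 5))"
    by (rule even_tr[OF _ _ _ nest_nbrs(4)[OF assms]]) (auto split: nat.splits)
  then show "even (tr (vx j 3) (case j of 0 \<Rightarrow> vx 0 5 | Suc i \<Rightarrow> vx i 5) + tr (vx j 1) (vx j 3) + tr (vx j 2) (vx j 3))"
    by (simp only: traversals_commute[of p "vx j 3" "vx j 1"] traversals_commute[of p "vx j 3" "vx j 2"] add_ac)
  have "even (tr (vx j 1) (vx j 0) + tr (vx j 1) (vx j 2) + tr (vx j 1) (vx j 3))"
    by (rule even_tr[OF _ _ _ nest_nbrs(2)[OF assms]]) (auto split: nat.splits)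
  then show "even (tr (vx j 0) (vx j 1) + tr (vx j 1) (vx j 2) + tr (vx j 1) (vx j 3))"
    by (simp only: traversals_commute[of p "vx j 1" "vx j 0"] add_ac)
  have "even (tr (vx j 2) (vx j 0) + tr (vx j 2) (vx j 1) + tr (vx j 2) (vx j 3))"
    by (rule even_tr[OF _ _ _ nest_nbrs(3)[OF assms]]) (auto split: nat.splits)
  then show "even (tr (vx j 0) (vx j 2) + tr (vx j 1) (vx j 2) + tr (vx j 2) (vx j 3))"
    by (simp only: traversals_commute[of p "vx j 2" "vx j 0"] traversals_commute[of p "vx j 2" "vx j 1"] add_ac)
qed

text \<open>The cuts for \<open>diamond_bound\<close> come from single vertices, the whole diamond,
  and the diamond without one tip.\<close>

lemma diamond_traversals:
  assumes j: "j \<le> K"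
  defines "l \<equiv> (case j of 0 \<Rightarrow> vx 0 4 | Suc i \<Rightarrow> vx i 4)" and "r \<equiv> (case j of 0 \<Rightarrow> vx 0 5 | Suc i \<Rightarrow> vx i 5)"
  shows "even (tr (vx j 0) l + tr (vx j 3) r) \<and>
    tr (vx j 0) l + tr (vx j 3) r + tr (vx j 0) (vx j 1) + tr (vx j 0) (vx j 2) + tr (vx j 1) (vx j 2)
      + tr (vx j 1) (vx j 3) + tr (vx j 2) (vx j 3) \<ge> 5 + of_bool (even (tr (vx j 0) l))"
proof (rule diamond_bound)
  note comm = traversals_commute[of p "vx _ 4" "vx (Suc _) 0"] traversals_commute[of p "vx _ 5" "vx (Suc _) 3"]
  show "tr (vx j 0) l + tr (vx j 0) (vx j 1) + tr (vx j 0) (vx j 2) \<ge> 1"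
    by (rule ccontr, rule crossing[of "\<lambda>i c. i = j \<and> c = 0" j 0])
      (use j in \<open>auto simp: l_def comm split: nat.splits\<close>)
  show "tr (vx j 3) r + tr (vx j 1) (vx j 3) + tr (vx j 2) (vx j 3) \<ge> 1"
    by (rule ccontr, rule crossing[of "\<lambda>i c. i = j \<and> c = 3" j 3])
      (use j in \<open>auto simp: r_def comm split: nat.splits\<close>)
  show "tr (vx j 0) (vx j 1) + tr (vx j 1) (vx j 2) + tr (vx j 1) (vx j 3) \<ge> 1"
    by (rule ccontr, rule crossing[of "\<lambda>i c. i = j \<and> c = 1" j 1])
      (use j in auto)
  show "tr (vx j 0) (vx j 2) + tr (vx j 1) (vx j 2) + tr (vx j 2) (vx j 3) \<ge> 1"
    by (rule ccontr, rule crossing[of "\<lambda>i c. i = j \<and> c = 2" j 2])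
      (use j in auto)
  show "tr (vx j 0) l + tr (vx j 3) r \<ge> 1"
    by (rule ccontr, rule crossing[of "\<lambda>i c. i = j \<and> c < 4" j 0])
      (use j in \<open>auto simp: l_def r_def comm split: nat.splits\<close>)
  show "tr (vx j 3) r + tr (vx j 0) (vx j 1) + tr (vx j 0) (vx j 2) \<ge> 1"
    by (rule ccontr, rule crossing[of "\<lambda>i c. i = j \<and> c \<in> {1, 2, 3}" j 1])
      (use j in \<open>auto simp: l_def r_def comm split: nat.splits\<close>)
  show "tr (vx j 0) l + tr (vx j 1) (vx j 3) + tr (vx j 2) (vx j 3) \<ge> 1"
    by (rule ccontr, rule crossing[of "\<lambda>i c. i = j \<and> c \<in> {0, 1, 2}" j 1])
      (use j in \<open>auto simp: l_def r_def comm split: nat.splits\<close>)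
qed (use even_diamond_degrees[OF j] in \<open>simp_all add: l_def r_def ac_simps\<close>)

lemma vx_less_vx_iff: "c < 8 \<Longrightarrow> d < 8 \<Longrightarrow> vx i c < vx j d \<longleftrightarrow> i < j \<or> i = j \<and> c < d"
  by (cases i j rule: linorder_cases) (auto simp: vx_def)

text \<open>The vertices below \<open>vx j 4\<close> form the piece with \<open>j\<close> layers.\<close>

definition touching :: "nat \<Rightarrow> nat" where
  "touching j = length (filter (\<lambda>(x, y). x < vx j 4 \<or> y < vx j 4) p)"

lemma touching_0:
  "tr (vx 0 0) (vx 0 4) + tr (vx 0 3) (vx 0 5) + tr (vx 0 0) (vx 0 1) + tr (vx 0 0) (vx 0 2)
    + tr (vx 0 1) (vx 0 2) + tr (vx 0 1) (vx 0 3) + tr (vx 0 2) (vx 0 3) \<le> touching 0"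
proof -
  define E where "E = {(vx 0 0, vx 0 4), (vx 0 3, vx 0 5), (vx 0 0, vx 0 1), (vx 0 0, vx 0 2),
    (vx 0 1, vx 0 2), (vx 0 1, vx 0 3), (vx 0 2, vx 0 3)}"
  have "length (filter (\<lambda>_. False) p) + (\<Sum>(x, y)\<in>E. tr x y) \<le> touching 0"
    unfolding touching_def by (rule length_filter_add_traversals_le) (auto simp: E_def vx_less_vx_iff)
  then show ?thesis by (simp add: E_def)
qed

text \<open>The added edges have both ends at or above \<open>vx j 4\<close>, so
  \<open>touching j\<close> misses them, but their lower ends lie below
  \<open>vx (Suc j) 4\<close>.\<close>

lemma touching_Suc:
  "touching j + (tr (vx j 4) (vx (Suc j) 0) + tr (vx j 5) (vx (Suc j) 3)
      + tr (vx (Suc j) 0) (vx (Suc j) 1) + tr (vx (Suc j) 0) (vx (Suc j) 2)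
      + tr (vx (Suc j) 1) (vx (Suc j) 2) + tr (vx (Suc j) 1) (vx (Suc j) 3) + tr (vx (Suc j) 2) (vx (Suc j) 3))
    + (tr (vx j 4) (vx j 6) + tr (vx j 5) (vx j 7) + tr (vx j 6) (vx j 7)
      + tr (vx j 6) (vx (Suc j) 4) + tr (vx j 7) (vx (Suc j) 5)) \<le> touching (Suc j)"
proof -
  define E where "E = {(vx j 4, vx (Suc j) 0), (vx j 5, vx (Suc j) 3),
    (vx (Suc j) 0, vx (Suc j) 1), (vx (Suc j) 0, vx (Suc j) 2), (vx (Suc j) 1, vx (Suc j) 2),
    (vx (Suc j) 1, vx (Suc j) 3), (vx (Suc j) 2, vx (Suc j) 3),
    (vx j 4, vx j 6), (vx j 5, vx j 7), (vx j 6, vx j 7), (vx j 6, vx (Suc j) 4), (vx j 7, vx (Suc j) 5)}"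
  have mono: "vx j 4 < vx (Suc j) 4" by (simp add: vx_less_vx_iff)
  have "touching j + (\<Sum>(x, y)\<in>E. tr x y) \<le> touching (Suc j)"
    unfolding touching_def
    by (rule length_filter_add_traversals_le)
      (auto simp: E_def vx_less_vx_iff dest: less_trans[OF _ mono])
  then show ?thesis by (simp add: E_def)
qed

text \<open>Induction by \<open>layer_bound\<close> with \<open>N = 10 * j\<close>.
  \<open>e j\<close> and \<open>f j\<close> belong to the edges leaving the piece, whose ends for
  \<open>j = 0\<close> are the tips of the innermost diamond.\<close>

lemma touching_bound:
  assumes "j \<le> K"
  defines "e \<equiv> \<lambda>j. tr (vx j 4) (case j of 0 \<Rightarrow> vx 0 0 | Suc i \<Rightarrow> vx i 6)"
    and "f \<equiv> \<lambda>j. tr (vx j 5) (case j of 0 \<Rightarrow> vx 0 3 | Suc i \<Rightarrow> vx i 7)"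
  shows "even (e j + f j) \<and> touching j \<ge> 10 * j + 5 + of_bool (even (e j))"
  using assms(1)
proof (induction j)
  case 0
  show ?case
    using diamond_traversals[of 0] touching_0
    by (auto simp: e_def f_def traversals_commute[of p "vx 0 4"] traversals_commute[of p "vx 0 5"])
next
  case (Suc j)
  let ?a = "tr (vx j 4) (vx (Suc j) 0)" and ?b = "tr (vx j 5) (vx (Suc j) 3)"
  let ?c = "tr (vx j 4) (vx j 6)" and ?d = "tr (vx j 5) (vx j 7)" and ?g = "tr (vx j 6) (vx j 7)"
  let ?D = "?a + ?b + tr (vx (Suc j) 0) (vx (Suc j) 1) + tr (vx (Suc j) 0) (vx (Suc j) 2)
    + tr (vx (Suc j) 1) (vx (Suc j) 2) + tr (vx (Suc j) 1) (vx (Suc j) 3) + tr (vx (Suc j) 2) (vx (Suc j) 3)"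
  have j: "j < K" and IH: "even (e j + f j)" "touching j \<ge> 10 * j + 5 + of_bool (even (e j))"
    using Suc by auto
  have e': "e (Suc j) = tr (vx j 6) (vx (Suc j) 4)" and f': "f (Suc j) = tr (vx j 7) (vx (Suc j) 5)"
    by (simp_all add: e_def f_def traversals_commute)
  have D: "even (?a + ?b)" "?D \<ge> 5 + of_bool (even ?a)"
    using diamond_traversals[of "Suc j"] j traversals_commute[of p "vx (Suc j) 0" "vx j 4"]
      traversals_commute[of p "vx (Suc j) 3" "vx j 5"] by auto
  have "even (e (Suc j) + f (Suc j))
      \<and> touching j + ?D + (?c + ?d + ?g + e (Suc j) + f (Suc j)) \<ge> 10 * j + 15 + of_bool (even (e (Suc j)))"
  proof (rule layer_bound[OF IH(2) D(2) IH(1) D(1)])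
    have "even (?c + e j + tr (vx j 4) (vx (Suc j) 0))"
      unfolding e_def
      by (rule even_tr) (use j nest_nbrs(5)[of j K] in \<open>auto split: nat.splits\<close>)
    then show "even (e j + ?a + ?c)"
      by (simp only: add_ac)
    have "even (?d + f j + tr (vx j 5) (vx (Suc j) 3))"
      unfolding f_def
      by (rule even_tr) (use j nest_nbrs(6)[of j K] in \<open>auto split: nat.splits\<close>)
    then show "even (f j + ?b + ?d)"
      by (simp only: add_ac)
    have "even (tr (vx j 6) (vx j 4) + ?g + e (Suc j))"
      unfolding e'
      by (rule even_tr) (use j nest_nbrs(7)[of j K] in auto)
    then show "even (?c + ?g + e (Suc j))"
      by (simp only: traversals_commute[of p "vx j 6" "vx j 4"])
    have "even (tr (vx j 7) (vx j 5) + tr (vx j 7) (vx j 6) + f (Suc j))"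
      unfolding f'
      by (rule even_tr) (use j nest_nbrs(8)[of j K] in auto)
    then show "even (?d + ?g + f (Suc j))"
      by (simp only: traversals_commute[of p "vx j 7" "vx j 5"] traversals_commute[of p "vx j 7" "vx j 6"])
    \<comment> \<open>The piece with \<open>Suc j\<close> layers, without those new ends of layer
      \<open>j\<close> whose indices lie in \<open>C\<close>.\<close>
    let ?Y = "\<lambda>C i c. i < j \<or> i = j \<and> c \<notin> C \<or> i = Suc j \<and> c < 4"
    show "?c + ?d \<ge> 1"
      by (rule ccontr, rule crossing[of "?Y {6, 7}" j 4]) (use j in auto)
    show "e (Suc j) + f (Suc j) \<ge> 1"
      unfolding e' f' by (rule ccontr, rule crossing[of "?Y {}" j 4]) (use j in auto)
    show "?c + ?g + e (Suc j) \<ge> 1"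
      unfolding e' f' by (rule ccontr, rule crossing[of "\<lambda>i c. i = j \<and> c = 6" j 6]) (use j in auto)
    show "?d + ?g + f (Suc j) \<ge> 1"
      unfolding e' f' by (rule ccontr, rule crossing[of "\<lambda>i c. i = j \<and> c = 7" j 7]) (use j in auto)
    show "?d + ?g + e (Suc j) \<ge> 1"
      unfolding e' f' by (rule ccontr, rule crossing[of "?Y {7}" j 4]) (use j in auto)
    show "?c + ?g + f (Suc j) \<ge> 1"
      unfolding e' f' by (rule ccontr, rule crossing[of "?Y {6}" j 4]) (use j in auto)
  qed
  moreover have "touching (Suc j) \<ge> touching j + ?D + (?c + ?d + ?g + e (Suc j) + f (Suc j))"
    using touching_Suc[of j]
    by (simp only: e' f' add_ac)
  ultimately show ?case by auto
qed

lemma length_ge: "length p \<ge> 10 * K + 5"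
proof -
  have "10 * K + 5 \<le> touching K" using touching_bound[of K] by simp
  also have "\<dots> \<le> length p" by (simp add: touching_def)
  finally show ?thesis .
qed

end

section \<open>Asymptotic consequences\<close>

lemma OPT_nest_ge: "real (OPT (nest K) (vx K 6) (vx K 7)) \<ge> 5 / 4 * real (card (pverts (nest K))) - 5"
proof -
  have "10 * K + 5 \<le> OPT (nest K) (vx K 6) (vx K 7)"
  proof (rule le_OPT[OF pair_graph_nest])
    show "connected (with_proj (nest K))"
      using two_connected_nest by (simp add: two_connected_def)
  next
    fix p assume "spanning_walk (nest K) (vx K 6) p (vx K 7)"
    then interpret nest_walk K p by unfold_locales
    show "10 * K + 5 \<le> length p" by (rule length_ge)
  qed simp_all
  then have "real (10 * K + 5) \<le> real (OPT (nest K) (vx K 6) (vx K 7))" by linarith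
  \<comment> \<open>With \<open>8 * K + 8\<close> vertices, the claimed bound is exactly
    \<open>10 * K + 5\<close>.\<close>
  then show ?thesis by (simp add: field_simps)
qed

lemma not_digraph_iso_nest:
  assumes "K \<noteq> L"
  shows "\<not> digraph_iso (with_proj (nest K)) (with_proj (nest L))"
proof
  assume "digraph_iso (with_proj (nest K)) (with_proj (nest L))"
  then obtain f where f: "pre_digraph.digraph_isomorphism (with_proj (nest K)) f"
    "with_proj (nest L) = app_iso f (with_proj (nest K))"
    by (auto simp: digraph_iso_def)
  then have "pverts (nest L) = iso_verts f ` pverts (nest K)"
    by (metis verts_app_iso with_proj_simps(1))
  moreover have "inj_on (iso_verts f) (pverts (nest K))"
    using f(1) by (simp add: pre_digraph.digraph_isomorphism_def)
  ultimately have "card (pverts (nest L)) = card (pverts (nest K))" by (simp add: card_image)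
  then show False using assms by simp
qed

lemma ex_OPT_nest_gt:
  fixes \<alpha> C :: real
  assumes "\<alpha> < 5 / 4"
  shows "\<exists>K. real (OPT (nest K) (vx K 6) (vx K 7)) > \<alpha> * real (card (pverts (nest K))) + C"
proof -
  \<comment> \<open>The gap between the slopes must outweigh \<open>C\<close> and the 5 from
    \<open>OPT_nest_ge\<close>; the crude estimate of at least \<open>K\<close> vertices
    suffices.\<close>
  obtain K :: nat where "real K > (C + 5) / (5 / 4 - \<alpha>)" using reals_Archimedean2 by blast
  then have "(5 / 4 - \<alpha>) * real K > C + 5" using assms by (simp add: field_simps)
  moreover have "(5 / 4 - \<alpha>) * real (card (pverts (nest K))) \<ge> (5 / 4 - \<alpha>) * real K"
    using assms by (intro mult_left_mono) simp_all
  ultimately have "5 / 4 * real (card (pverts (nest K))) - 5 > \<alpha> * real (card (pverts (nest K))) + C"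
    by (simp only: left_diff_distrib)
  then show ?thesis using OPT_nest_ge[of K] by (intro exI[of _ K]) linarith
qed

theorem theorem2:
  shows
    "(\<exists>(C :: real) (\<G> :: nat pair_pre_digraph set).
        infinite \<G> \<and>
        pairwise (\<lambda>G H. \<not> digraph_iso (with_proj G) (with_proj H)) \<G> \<and>
        (\<forall>G \<in> \<G>. pair_graph G \<and> two_connected G \<and> cubic G \<and>
           (\<exists>s t. (s, t) \<in> parcs G \<and>
              real (OPT G s t) \<ge> 5 / 4 * real (card (pverts G)) - C)))
     \<and> (\<forall>(\<alpha> :: real) (C' :: real). \<alpha> < 5 / 4 \<longrightarrow>
          \<not> (\<forall>G :: nat pair_pre_digraph. pair_graph G \<and> two_connected G \<and> cubic G \<longrightarrow>
               (\<forall>s \<in> pverts G. \<forall>t \<in> pverts G. s \<noteq> t \<longrightarrow>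
                  real (OPT G s t) \<le> \<alpha> * real (card (pverts G)) + C')))
     \<and> (\<forall>(\<alpha> :: real) (C' :: real). \<alpha> < 5 / 4 \<longrightarrow>
          \<not> (\<forall>G :: nat pair_pre_digraph. pair_graph G \<and> two_connected G \<and> subcubic G \<longrightarrow>
               (\<forall>s \<in> pverts G. \<forall>t \<in> pverts G. s \<noteq> t \<longrightarrow>
                  real (OPT G s t) \<le> \<alpha> * real (card (pverts G)) + C')))"
proof (intro conjI allI impI)
  have "infinite (range nest)"
    by (rule range_inj_infinite, rule injI) (metis card_lessThan pverts_nest add_right_cancel mult_cancel1 zero_neq_numeral)
  moreover have "pairwise (\<lambda>G H. \<not> digraph_iso (with_proj G) (with_proj H)) (range nest)"
  proof (rule pairwiseI)
    fix G H assume "G \<in> range nest" "H \<in> range nest" "G \<noteq> H"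
    then obtain K L where "G = nest K" "H = nest L" "K \<noteq> L" by auto
    then show "\<not> digraph_iso (with_proj G) (with_proj H)" by (simp add: not_digraph_iso_nest)
  qed
  moreover have "pair_graph G \<and> two_connected G \<and> cubic G \<and>
      (\<exists>s t. (s, t) \<in> parcs G \<and> real (OPT G s t) \<ge> 5 / 4 * real (card (pverts G)) - 5)"
    if "G \<in> range nest" for G
    using that pair_graph_nest two_connected_nest cubic_nest st_arc OPT_nest_ge by fast
  ultimately show "\<exists>(C :: real) (\<G> :: nat pair_pre_digraph set).
        infinite \<G> \<and>
        pairwise (\<lambda>G H. \<not> digraph_iso (with_proj G) (with_proj H)) \<G> \<and>
        (\<forall>G \<in> \<G>. pair_graph G \<and> two_connected G \<and> cubic G \<and>
           (\<exists>s t. (s, t) \<in> parcs G \<and>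
              real (OPT G s t) \<ge> 5 / 4 * real (card (pverts G)) - C))"
    by (intro exI[of _ 5] exI[of _ "range nest"]) blast
next
  fix \<alpha> C' :: real
  assume "\<alpha> < 5 / 4"
  then obtain K where K: "real (OPT (nest K) (vx K 6) (vx K 7)) > \<alpha> * real (card (pverts (nest K))) + C'"
    using ex_OPT_nest_gt by blast
  have st: "vx K 6 \<in> pverts (nest K)" "vx K 7 \<in> pverts (nest K)" "vx K 6 \<noteq> vx K 7" by simp_all
  show "\<not> (\<forall>G :: nat pair_pre_digraph. pair_graph G \<and> two_connected G \<and> cubic G \<longrightarrow>
               (\<forall>s \<in> pverts G. \<forall>t \<in> pverts G. s \<noteq> t \<longrightarrow>
                  real (OPT G s t) \<le> \<alpha> * real (card (pverts G)) + C'))"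
    using K st pair_graph_nest two_connected_nest cubic_nest linorder_not_le by blast
  have "subcubic (nest K)" using cubic_nest by (simp add: cubic_def subcubic_def)
  then show "\<not> (\<forall>G :: nat pair_pre_digraph. pair_graph G \<and> two_connected G \<and> subcubic G \<longrightarrow>
               (\<forall>s \<in> pverts G. \<forall>t \<in> pverts G. s \<noteq> t \<longrightarrow>
                  real (OPT G s t) \<le> \<alpha> * real (card (pverts G)) + C'))"
    using K st pair_graph_nest two_connected_nest linorder_not_le by blast
qed

end
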